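(* Define, for $(t,x,y)\in[0,T]\times\mathbb R\times\mathbb R_+$, $$\phi(t,x,y)=e^{\int_t^T r(s)ds}\,xy+\frac1{2\theta}e^{\int_t^T\rho(s)ds}\,y^2+\mu_0(\kappa-\kappa_r)\,y\int_t^T e^{\int_s^T r(v)dv}ds .$$ Then $\phi\in C^{1,2,2}([0,T]\times\mathbb R\times\mathbb R_+)$ and $\phi$ is a solution of the HJBI equation $$\begin{cases}\mathcal L_t^{\hat a,\hat b}\phi(t,x,y)=0,\\ \mathcal L_t^{\hat a,b}\phi(t,x,y)\ge 0\quad\text{for all } b=(p,q),\\ \mathcal L_t^{a,\hat b}\phi(t,x,y)\le 0\quad\text{for all } a=(\pi,u)\in\mathbb R\times\mathbb R_+,\\ \phi(T,x,y)=xy+\frac1{2\theta}y^2,\end{cases}$$ the first three lines holding for all $(t,x,y)\in[0,T)\times\mathbb R\times\mathbb R_+$. The saddle point $(\hat a,\hat b)$ of this HJBI equation is given by $$\hat a(t,x,y)=(\hat\pi,\hat u)(t,x,y)=\frac1\theta\Big(\frac{\mu(t)-r(t)}{\sigma(t)^2},\ \frac{\mu_0\kappa_r}{\sigma_0^2}\Big)e^{\int_t^T(\rho(s)-r(s))ds}\,y,$$ $$\hat b(t,z,x,y)=(\hat p(t,x,y),\hat q(t,z,x,y))=\Big(-\frac{\mu(t)-r(t)}{\sigma(t)},\ \frac{\mu_0\kappa_r z}{\sigma_0^2}\Big).$$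
   Context: Here $T>0$, $\theta>0$ and $0<\kappa\le\kappa_r$ are constants; $r,\mu,\sigma:[0,T]\to(0,\infty)$ are bounded deterministic functions with $\mu(t)>r(t)$ and $\sigma(t)>\underline\sigma>0$ for all $t\in[0,T]$; $v$ is a (Lévy) measure on a set $K\subset(0,\infty)$ of claim sizes with $\mu_0:=\int_K z\,v(dz)\in(0,\infty)$ and $\sigma_0^2:=\int_K z^2v(dz)\in(0,\infty)$; and $$\rho(t):=\frac{\mu_0^2\kappa_r^2}{\sigma_0^2}+\frac{(\mu(t)-r(t))^2}{\sigma(t)^2}.$$ For $a=(\pi,u)\in\mathbb R\times\mathbb R_+$ and $b=(p,q)$, where $p\in\mathbb R$ and $q(z)\in\mathbb R$ for each jump size $z\in K$, and a smooth function $\phi(t,x,y)$, put $$\begin{aligned}\mathcal L_t^{a,b}\phi(t,x,y)=&\ \phi_t+\big[r(t)x+\pi(\mu(t)-r(t))+\mu_0\kappa_r u+\mu_0(\kappa-\kappa_r)\big]\phi_x+\tfrac12\pi^2\sigma(t)^2\phi_{xx}+\tfrac12y^2p^2\phi_{yy}+y\pi\sigma(t)p\,\phi_{xy}\\&+\int_K\big\{\phi(t,x-uz,y+yq(z))-\phi(t,x,y)+uz\,\phi_x-yq(z)\phi_y\big\}v(dz),\end{aligned}$$ with derivatives evaluated at $(t,x,y)$. The polynomial formula for $\phi$ is used also when $y+yq(z)<0$.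
   Formalization: The functions r and ρ are additionally assumed continuous on [0,T]; for merely bounded coefficients (e.g. r with a jump inside (0,T)) φ_t fails to exist and φ is not C^{1,2,2}. *)

theory Defs
  imports "HOL-Analysis.Analysis"
begin

section \<open>Market data\<close>

text \<open>
  The claim measure \<open>v\<close> lives on \<open>K\<close> itself (\<open>space v = K\<close>, trace Borel sets), so an integral
  with respect to \<open>v\<close> is an integral over \<open>K\<close>.
\<close>

definition mu0 :: "real measure \<Rightarrow> real" where
  "mu0 v = (LINT z|v. z)"

definition sigma0_sq :: "real measure \<Rightarrow> real" where
  "sigma0_sq v = (LINT z|v. z\<^sup>2)"

definition rho ::
  "real measure \<Rightarrow> real \<Rightarrow> (real \<Rightarrow> real) \<Rightarrow> (real \<Rightarrow> real) \<Rightarrow> (real \<Rightarrow> real) \<Rightarrow> real \<Rightarrow> real" where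
  "rho v \<kappa>r r \<mu> \<sigma> t = (mu0 v)\<^sup>2 * \<kappa>r\<^sup>2 / sigma0_sq v + (\<mu> t - r t)\<^sup>2 / (\<sigma> t)\<^sup>2"


section \<open>Partial derivatives and the class \<open>C\<^sup>1\<^sup>,\<^sup>2\<^sup>,\<^sup>2([0,T] \<times> \<real> \<times> [0,\<infinity>))\<close>\<close>

text \<open>
  Derivatives are taken within the domain, hence one-sided at \<open>t = 0\<close>, \<open>t = T\<close> and \<open>y = 0\<close>.
\<close>

definition dt :: "real \<Rightarrow> (real \<Rightarrow> real \<Rightarrow> real \<Rightarrow> real) \<Rightarrow> real \<Rightarrow> real \<Rightarrow> real \<Rightarrow> real" where
  "dt T f t x y = vector_derivative (\<lambda>s. f s x y) (at t within {0..T})"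

definition dx :: "(real \<Rightarrow> real \<Rightarrow> real \<Rightarrow> real) \<Rightarrow> real \<Rightarrow> real \<Rightarrow> real \<Rightarrow> real" where
  "dx f t x y = vector_derivative (\<lambda>\<xi>. f t \<xi> y) (at x)"

definition dy :: "(real \<Rightarrow> real \<Rightarrow> real \<Rightarrow> real) \<Rightarrow> real \<Rightarrow> real \<Rightarrow> real \<Rightarrow> real" where
  "dy f t x y = vector_derivative (\<lambda>\<eta>. f t x \<eta>) (at y within {0..})"

definition dt_exists :: "real \<Rightarrow> (real \<Rightarrow> real \<Rightarrow> real \<Rightarrow> real) \<Rightarrow> bool" where
  "dt_exists T f \<longleftrightarrow>
     (\<forall>t\<in>{0..T}. \<forall>x. \<forall>y\<ge>0. (\<lambda>s. f s x y) differentiable (at t within {0..T}))"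

definition dx_exists :: "real \<Rightarrow> (real \<Rightarrow> real \<Rightarrow> real \<Rightarrow> real) \<Rightarrow> bool" where
  "dx_exists T f \<longleftrightarrow>
     (\<forall>t\<in>{0..T}. \<forall>x. \<forall>y\<ge>0. (\<lambda>\<xi>. f t \<xi> y) differentiable (at x))"

definition dy_exists :: "real \<Rightarrow> (real \<Rightarrow> real \<Rightarrow> real \<Rightarrow> real) \<Rightarrow> bool" where
  "dy_exists T f \<longleftrightarrow>
     (\<forall>t\<in>{0..T}. \<forall>x. \<forall>y\<ge>0. (\<lambda>\<eta>. f t x \<eta>) differentiable (at y within {0..}))"

definition jointly_continuous :: "real \<Rightarrow> (real \<Rightarrow> real \<Rightarrow> real \<Rightarrow> real) \<Rightarrow> bool" where
  "jointly_continuous T f \<longleftrightarrow>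
     continuous_on ({0..T} \<times> UNIV \<times> {0..}) (\<lambda>(t, x, y). f t x y)"

definition C122 :: "real \<Rightarrow> (real \<Rightarrow> real \<Rightarrow> real \<Rightarrow> real) \<Rightarrow> bool" where
  "C122 T f \<longleftrightarrow>
     dt_exists T f \<and> dx_exists T f \<and> dy_exists T f \<and>
     dx_exists T (dx f) \<and> dy_exists T (dx f) \<and> dx_exists T (dy f) \<and> dy_exists T (dy f) \<and>
     jointly_continuous T f \<and>
     jointly_continuous T (dt T f) \<and> jointly_continuous T (dx f) \<and> jointly_continuous T (dy f) \<and>
     jointly_continuous T (dx (dx f)) \<and> jointly_continuous T (dy (dx f)) \<and>
     jointly_continuous T (dx (dy f)) \<and> jointly_continuous T (dy (dy f))"


section \<open>The operator \<open>L\<^sub>t\<^sup>a\<^sup>,\<^sup>b\<close> with \<open>a = (\<pi>, u)\<close> and \<open>b = (p, q)\<close>\<close>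

text \<open>
  No integrability is imposed on \<open>q\<close>, so the jump integral may be infinite.  It is taken as the
  extended real \<open>\<integral> f\<^sup>+ dv - \<integral> f\<^sup>- dv\<close>; \<open>integral_exists\<close> excludes the meaningless case
  \<open>\<infinity> - \<infinity>\<close>.  For Lebesgue integrable \<open>f\<close> this is the Bochner integral.
\<close>

definition ext_integral :: "real measure \<Rightarrow> (real \<Rightarrow> real) \<Rightarrow> ereal" where
  "ext_integral v f =
     enn2ereal (\<integral>\<^sup>+z. ennreal (f z) \<partial>v) - enn2ereal (\<integral>\<^sup>+z. ennreal (- f z) \<partial>v)"

definition integral_exists :: "real measure \<Rightarrow> (real \<Rightarrow> real) \<Rightarrow> bool" where
  "integral_exists v f \<longleftrightarrow> f \<in> borel_measurable v \<and>
     ((\<integral>\<^sup>+z. ennreal (f z) \<partial>v) < \<infinity> \<or> (\<integral>\<^sup>+z. ennreal (- f z) \<partial>v) < \<infinity>)"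

definition jump ::
  "(real \<Rightarrow> real \<Rightarrow> real \<Rightarrow> real) \<Rightarrow> real \<Rightarrow> (real \<Rightarrow> real) \<Rightarrow> real \<Rightarrow> real \<Rightarrow> real \<Rightarrow> real \<Rightarrow> real" where
  "jump f u q t x y z =
     f t (x - u * z) (y + y * q z) - f t x y + u * z * dx f t x y - y * q z * dy f t x y"

definition L_op ::
  "real \<Rightarrow> real \<Rightarrow> real \<Rightarrow> (real \<Rightarrow> real) \<Rightarrow> (real \<Rightarrow> real) \<Rightarrow> (real \<Rightarrow> real) \<Rightarrow> real measure \<Rightarrow>
   real \<Rightarrow> real \<Rightarrow> real \<Rightarrow> (real \<Rightarrow> real) \<Rightarrow>
   (real \<Rightarrow> real \<Rightarrow> real \<Rightarrow> real) \<Rightarrow> real \<Rightarrow> real \<Rightarrow> real \<Rightarrow> ereal" where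
  "L_op T \<kappa> \<kappa>r r \<mu> \<sigma> v \<pi> u p q f t x y =
     ereal (dt T f t x y
       + (r t * x + \<pi> * (\<mu> t - r t) + mu0 v * \<kappa>r * u + mu0 v * (\<kappa> - \<kappa>r)) * dx f t x y
       + 1/2 * \<pi>\<^sup>2 * (\<sigma> t)\<^sup>2 * dx (dx f) t x y
       + 1/2 * y\<^sup>2 * p\<^sup>2 * dy (dy f) t x y
       + y * \<pi> * \<sigma> t * p * dy (dx f) t x y)
     + ext_integral v (jump f u q t x y)"


section \<open>The explicit solution and the saddle point\<close>

definition phi ::
  "real \<Rightarrow> real \<Rightarrow> real \<Rightarrow> real \<Rightarrow> (real \<Rightarrow> real) \<Rightarrow> (real \<Rightarrow> real) \<Rightarrow> (real \<Rightarrow> real) \<Rightarrow> real measure \<Rightarrow>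
   real \<Rightarrow> real \<Rightarrow> real \<Rightarrow> real" where
  "phi T \<theta> \<kappa> \<kappa>r r \<mu> \<sigma> v t x y =
     exp (integral {t..T} r) * x * y
     + 1 / (2 * \<theta>) * exp (integral {t..T} (rho v \<kappa>r r \<mu> \<sigma>)) * y\<^sup>2
     + mu0 v * (\<kappa> - \<kappa>r) * y * integral {t..T} (\<lambda>s. exp (integral {s..T} r))"

definition pi_hat ::
  "real \<Rightarrow> real \<Rightarrow> real \<Rightarrow> (real \<Rightarrow> real) \<Rightarrow> (real \<Rightarrow> real) \<Rightarrow> (real \<Rightarrow> real) \<Rightarrow> real measure \<Rightarrow>
   real \<Rightarrow> real \<Rightarrow> real \<Rightarrow> real" where
  "pi_hat T \<theta> \<kappa>r r \<mu> \<sigma> v t x y =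
     1 / \<theta> * ((\<mu> t - r t) / (\<sigma> t)\<^sup>2)
       * exp (integral {t..T} (\<lambda>s. rho v \<kappa>r r \<mu> \<sigma> s - r s)) * y"

definition u_hat ::
  "real \<Rightarrow> real \<Rightarrow> real \<Rightarrow> (real \<Rightarrow> real) \<Rightarrow> (real \<Rightarrow> real) \<Rightarrow> (real \<Rightarrow> real) \<Rightarrow> real measure \<Rightarrow>
   real \<Rightarrow> real \<Rightarrow> real \<Rightarrow> real" where
  "u_hat T \<theta> \<kappa>r r \<mu> \<sigma> v t x y =
     1 / \<theta> * (mu0 v * \<kappa>r / sigma0_sq v)
       * exp (integral {t..T} (\<lambda>s. rho v \<kappa>r r \<mu> \<sigma> s - r s)) * y"

definition p_hat ::
  "(real \<Rightarrow> real) \<Rightarrow> (real \<Rightarrow> real) \<Rightarrow> (real \<Rightarrow> real) \<Rightarrow> real \<Rightarrow> real \<Rightarrow> real \<Rightarrow> real" where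
  "p_hat r \<mu> \<sigma> t x y = - ((\<mu> t - r t) / \<sigma> t)"

definition q_hat :: "real \<Rightarrow> real measure \<Rightarrow> real \<Rightarrow> real \<Rightarrow> real \<Rightarrow> real \<Rightarrow> real" where
  "q_hat \<kappa>r v t z x y = mu0 v * \<kappa>r * z / sigma0_sq v"

text \<open>
  First three lines of the HJBI equation, for candidate controls \<open>(\<pi>\<^sub>s, u\<^sub>s)\<close> and
  \<open>(p\<^sub>s, q\<^sub>s)\<close> in feedback form.  The first conjuncts say that the controls take admissible
  values; every value of the operator that is compared with \<open>0\<close> is also asserted to be well defined.
\<close>

definition hjbi_saddle ::
  "real \<Rightarrow> real \<Rightarrow> real \<Rightarrow> (real \<Rightarrow> real) \<Rightarrow> (real \<Rightarrow> real) \<Rightarrow> (real \<Rightarrow> real) \<Rightarrow> real measure \<Rightarrow>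
   (real \<Rightarrow> real \<Rightarrow> real \<Rightarrow> real) \<Rightarrow>
   (real \<Rightarrow> real \<Rightarrow> real \<Rightarrow> real) \<Rightarrow> (real \<Rightarrow> real \<Rightarrow> real \<Rightarrow> real) \<Rightarrow>
   (real \<Rightarrow> real \<Rightarrow> real \<Rightarrow> real) \<Rightarrow> (real \<Rightarrow> real \<Rightarrow> real \<Rightarrow> real \<Rightarrow> real) \<Rightarrow> bool" where
  "hjbi_saddle T \<kappa> \<kappa>r r \<mu> \<sigma> v f \<pi>\<^sub>s u\<^sub>s p\<^sub>s q\<^sub>s \<longleftrightarrow>
     (\<forall>t\<in>{0..<T}. \<forall>x. \<forall>y\<ge>0.
        let \<pi>' = \<pi>\<^sub>s t x y; u' = u\<^sub>s t x y; p' = p\<^sub>s t x y; q' = (\<lambda>z. q\<^sub>s t z x y) in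
        u' \<ge> 0 \<and> q' \<in> borel_measurable v \<and>
        (integral_exists v (jump f u' q' t x y) \<and>
         L_op T \<kappa> \<kappa>r r \<mu> \<sigma> v \<pi>' u' p' q' f t x y = 0) \<and>
        (\<forall>p. \<forall>q\<in>borel_measurable v.
           integral_exists v (jump f u' q t x y) \<and>
           L_op T \<kappa> \<kappa>r r \<mu> \<sigma> v \<pi>' u' p q f t x y \<ge> 0) \<and>
        (\<forall>\<pi>. \<forall>u\<ge>0.
           integral_exists v (jump f u q' t x y) \<and>
           L_op T \<kappa> \<kappa>r r \<mu> \<sigma> v \<pi> u p' q' f t x y \<le> 0))"

end

theory Submission
  imports Defs
begin

text \<open>
  The function \<open>\<phi>\<close> has the form \<open>\<phi>(t,x,y) = A(t) x y + B(t) y\<^sup>2 + C(t) y\<close>, and the coefficients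
  solve \<open>A' = - r A\<close>, \<open>B' = - \<rho> B\<close>, \<open>C' = - \<mu>\<^sub>0 (\<kappa> - \<kappa>\<^sub>r) A\<close> on \<open>[0,T]\<close>.  Because \<open>\<phi>\<close> is
  affine in \<open>x\<close> and quadratic in \<open>y\<close>, the jump integrand collapses to
  \<open>B y\<^sup>2 q\<^sup>2 - A u y z q\<close>.  The equations for \<open>A\<close> and \<open>C\<close> cancel the part of the drift that does not
  involve a control, and the equation for \<open>B\<close> contributes \<open>- \<rho> B y\<^sup>2\<close>.  What is left is
  \<open>L = B y\<^sup>2 (p\<^sup>2 - \<rho>) + A y (\<pi> (\<mu> - r) + \<mu>\<^sub>0 \<kappa>\<^sub>r u + \<pi> \<sigma> p) + \<integral> (B y\<^sup>2 q\<^sup>2 - A u y z q) dv\<close>.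

  Put \<open>\<lambda> = \<mu>\<^sub>0 \<kappa>\<^sub>r / \<sigma>\<^sub>0\<^sup>2\<close> and \<open>m = (\<mu> - r) / \<sigma>\<close>, so that \<open>\<rho> = \<lambda>\<^sup>2 \<sigma>\<^sub>0\<^sup>2 + m\<^sup>2\<close>.
  The candidate \<open>(\<pi>,u)\<close> is chosen such that \<open>A \<pi> = 2 B y m / \<sigma>\<close> and \<open>A u = 2 B y \<lambda>\<close>.  With it,
  completing squares turns \<open>L\<close> into \<open>B y\<^sup>2 ((p + m)\<^sup>2 + \<integral> (q - \<lambda> z)\<^sup>2 dv)\<close>, which is nonnegative and
  vanishes at \<open>p = - m\<close>, \<open>q = \<lambda> z\<close>.  With this \<open>(p,q)\<close>, on the other hand, the coefficients of
  \<open>\<pi>\<close> and \<open>u\<close> in \<open>L\<close> vanish, so \<open>L = 0\<close> for every \<open>(\<pi>,u)\<close>, which is the remaining inequality.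

  Since \<open>q\<close> is an arbitrary measurable function, the jump integral may be \<open>+\<infinity>\<close>.  It is bounded
  below by completing the square under the integral, before integrating: the integrand dominates
  a multiple of \<open>z\<^sup>2\<close>, which is integrable.
\<close>

section \<open>Functions of the form \<open>A(t) x y + B(t) y\<^sup>2 + C(t) y\<close>\<close>

definition ansatz :: "(real \<Rightarrow> real) \<Rightarrow> (real \<Rightarrow> real) \<Rightarrow> (real \<Rightarrow> real) \<Rightarrow> real \<Rightarrow> real \<Rightarrow> real \<Rightarrow> real" where
  "ansatz A B C t x y = A t * x * y + B t * y\<^sup>2 + C t * y"

text \<open>
  One-sided derivatives at \<open>y = 0\<close> are unique because \<open>0\<close> is a limit point of the half-line.
\<close>

lemma half_line_derivative:
  fixes f :: "real \<Rightarrow> real"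
  assumes "(f has_real_derivative d) (at y within {0..})" "y \<ge> 0"
  shows "vector_derivative f (at y within {0..}) = d"
proof (rule vector_derivative_within)
  have "y islimpt {0..}"
  proof (rule islimpt_subset)
    show "y islimpt {y<..<y+1}"
      by (simp add: islimpt_greaterThanLessThan1)
  qed (use assms(2) in auto)
  then show "at y within {0..} \<noteq> bot"
    by (simp add: trivial_limit_within)
  show "(f has_vector_derivative d) (at y within {0..})"
    using assms(1) by (simp add: has_real_derivative_iff_has_vector_derivative)
qed

lemma has_dx_ansatz:
  "((\<lambda>\<xi>. ansatz A B C t \<xi> y) has_real_derivative A t * y) (at x)"
  unfolding ansatz_def by (auto intro!: derivative_eq_intros)

lemma has_dy_ansatz:
  "((\<lambda>\<eta>. ansatz A B C t x \<eta>) has_real_derivative A t * x + 2 * B t * y + C t) (at y within S)"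
  unfolding ansatz_def by (auto intro!: derivative_eq_intros)

lemma dx_ansatz: "dx (ansatz A B C) t x y = A t * y"
  unfolding dx_def
  using has_dx_ansatz[THEN has_real_derivative_iff_has_vector_derivative[THEN iffD1]]
  by (rule vector_derivative_at)

lemma dy_ansatz: "y \<ge> 0 \<Longrightarrow> dy (ansatz A B C) t x y = A t * x + 2 * B t * y + C t"
  unfolding dy_def using has_dy_ansatz by (rule half_line_derivative)

lemma has_dx_dx_ansatz:
  "((\<lambda>\<xi>. dx (ansatz A B C) t \<xi> y) has_real_derivative 0) (at x)"
  unfolding dx_ansatz by simp

lemma has_dy_dx_ansatz:
  "((\<lambda>\<eta>. dx (ansatz A B C) t x \<eta>) has_real_derivative A t) (at y within S)"
  unfolding dx_ansatz by (auto intro!: derivative_eq_intros)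

lemma has_dx_dy_ansatz:
  "y \<ge> 0 \<Longrightarrow> ((\<lambda>\<xi>. dy (ansatz A B C) t \<xi> y) has_real_derivative A t) (at x)"
  unfolding dy_ansatz by (auto intro!: derivative_eq_intros)

lemma has_dy_dy_ansatz:
  assumes "y \<ge> 0"
  shows "((\<lambda>\<eta>. dy (ansatz A B C) t x \<eta>) has_real_derivative 2 * B t) (at y within {0..})"
proof (rule has_field_derivative_transform_within[OF _ zero_less_one])
  show "((\<lambda>\<eta>. A t * x + 2 * B t * \<eta> + C t) has_real_derivative 2 * B t) (at y within {0..})"
    by (auto intro!: derivative_eq_intros)
qed (use assms in \<open>simp_all add: dy_ansatz\<close>)

lemma dx_dx_ansatz: "dx (dx (ansatz A B C)) t x y = 0"
  unfolding dx_def[of "dx _"]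
  using has_dx_dx_ansatz[THEN has_real_derivative_iff_has_vector_derivative[THEN iffD1]]
  by (rule vector_derivative_at)

lemma dy_dx_ansatz: "y \<ge> 0 \<Longrightarrow> dy (dx (ansatz A B C)) t x y = A t"
  unfolding dy_def[of "dx _"] using has_dy_dx_ansatz by (rule half_line_derivative)

lemma dx_dy_ansatz: "y \<ge> 0 \<Longrightarrow> dx (dy (ansatz A B C)) t x y = A t"
  unfolding dx_def[of "dy _"]
  using has_dx_dy_ansatz[THEN has_real_derivative_iff_has_vector_derivative[THEN iffD1]]
  by (rule vector_derivative_at)

lemma dy_dy_ansatz: "y \<ge> 0 \<Longrightarrow> dy (dy (ansatz A B C)) t x y = 2 * B t"
  unfolding dy_def[of "dy _"] using has_dy_dy_ansatz by (rule half_line_derivative)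

lemma has_dt_ansatz:
  assumes "(A has_real_derivative A') (at t within S)"
    and "(B has_real_derivative B') (at t within S)"
    and "(C has_real_derivative C') (at t within S)"
  shows "((\<lambda>s. ansatz A B C s x y) has_real_derivative ansatz (\<lambda>_. A') (\<lambda>_. B') (\<lambda>_. C') t x y)
    (at t within S)"
  unfolding ansatz_def using assms by (auto intro!: derivative_eq_intros)

lemma dt_ansatz:
  assumes "(A has_real_derivative A') (at t within {0..T})"
    and "(B has_real_derivative B') (at t within {0..T})"
    and "(C has_real_derivative C') (at t within {0..T})"
    and "t \<in> {0..T}" "T > 0"
  shows "dt T (ansatz A B C) t x y = ansatz (\<lambda>_. A') (\<lambda>_. B') (\<lambda>_. C') t x y"
  unfolding dt_def
  by (rule vector_derivative_within_closed_interval[OF assms(5,4)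
        has_dt_ansatz[OF assms(1-3), THEN has_real_derivative_iff_has_vector_derivative[THEN iffD1]]])

lemma jointly_continuous_cong:
  assumes "\<And>t x y. t \<in> {0..T} \<Longrightarrow> y \<ge> 0 \<Longrightarrow> f t x y = g t x y"
  shows "jointly_continuous T f \<longleftrightarrow> jointly_continuous T g"
  unfolding jointly_continuous_def using assms by (intro continuous_on_cong) auto

lemma C122_ansatz:
  assumes "T > 0"
    and A: "\<And>t. t \<in> {0..T} \<Longrightarrow> (A has_real_derivative A' t) (at t within {0..T})"
    and B: "\<And>t. t \<in> {0..T} \<Longrightarrow> (B has_real_derivative B' t) (at t within {0..T})"
    and C: "\<And>t. t \<in> {0..T} \<Longrightarrow> (C has_real_derivative C' t) (at t within {0..T})"
    and cont': "continuous_on {0..T} A'" "continuous_on {0..T} B'" "continuous_on {0..T} C'"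
  shows "C122 T (ansatz A B C)"
proof -
  let ?D = "{0..T} \<times> UNIV \<times> {0..} :: (real \<times> real \<times> real) set"
  have diff: "f differentiable (at x within S)" if "(f has_real_derivative d) (at x within S)"
    for f :: "real \<Rightarrow> real" and d x S
    using that real_differentiable_def by blast
  have cont: "continuous_on {0..T} A" "continuous_on {0..T} B" "continuous_on {0..T} C"
    by (rule DERIV_continuous_on[OF A] DERIV_continuous_on[OF B] DERIV_continuous_on[OF C]; assumption)+
  have lift: "continuous_on ?D (\<lambda>w. f (fst w))" if "continuous_on {0..T} f" for f :: "real \<Rightarrow> real"
    by (rule continuous_on_compose2[OF that continuous_on_fst[OF continuous_on_id]]) auto
  note cnt = lift[OF cont(1)] lift[OF cont(2)] lift[OF cont(3)]
    lift[OF cont'(1)] lift[OF cont'(2)] lift[OF cont'(3)]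
  have "dt_exists T (ansatz A B C)"
    unfolding dt_exists_def by (intro ballI allI impI diff[OF has_dt_ansatz[OF A B C]])
  moreover have "dx_exists T (ansatz A B C)" "dy_exists T (ansatz A B C)"
    "dx_exists T (dx (ansatz A B C))" "dy_exists T (dx (ansatz A B C))"
    "dx_exists T (dy (ansatz A B C))" "dy_exists T (dy (ansatz A B C))"
    unfolding dx_exists_def dy_exists_def
    by (intro ballI allI impI,
        (rule diff[OF has_dx_ansatz] diff[OF has_dy_ansatz] diff[OF has_dx_dx_ansatz]
          diff[OF has_dy_dx_ansatz] diff[OF has_dx_dy_ansatz] diff[OF has_dy_dy_ansatz];
          assumption?))+
  moreover have "jointly_continuous T (ansatz A B C)"
    unfolding jointly_continuous_def ansatz_def case_prod_beta
    by (intro continuous_intros cnt)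
  moreover have "jointly_continuous T (dt T (ansatz A B C))"
  proof (subst jointly_continuous_cong)
    show "dt T (ansatz A B C) t x y = ansatz A' B' C' t x y" if "t \<in> {0..T}" for t x y
      using dt_ansatz[OF A B C, of t x y] that \<open>T > 0\<close> by (simp add: ansatz_def)
    show "jointly_continuous T (ansatz A' B' C')"
      unfolding jointly_continuous_def ansatz_def case_prod_beta
      by (intro continuous_intros cnt)
  qed
  moreover have "jointly_continuous T (dx (ansatz A B C))"
    unfolding jointly_continuous_def dx_ansatz case_prod_beta
    by (intro continuous_intros cnt)
  moreover have "jointly_continuous T (dy (ansatz A B C))"
    by (subst jointly_continuous_cong[where g = "\<lambda>t x y. A t * x + 2 * B t * y + C t"], simp add: dy_ansatz,
        unfold jointly_continuous_def case_prod_beta, intro continuous_intros cnt)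
  moreover have "jointly_continuous T (dx (dx (ansatz A B C)))"
    unfolding jointly_continuous_def dx_dx_ansatz case_prod_beta
    by (intro continuous_intros)
  moreover have "jointly_continuous T (dy (dx (ansatz A B C)))"
    by (subst jointly_continuous_cong[where g = "\<lambda>t x y. A t"], simp add: dy_dx_ansatz,
        unfold jointly_continuous_def case_prod_beta, intro cnt)
  moreover have "jointly_continuous T (dx (dy (ansatz A B C)))"
    by (subst jointly_continuous_cong[where g = "\<lambda>t x y. A t"], simp add: dx_dy_ansatz,
        unfold jointly_continuous_def case_prod_beta, intro cnt)
  moreover have "jointly_continuous T (dy (dy (ansatz A B C)))"
    by (subst jointly_continuous_cong[where g = "\<lambda>t x y. 2 * B t"], simp add: dy_dy_ansatz,
        unfold jointly_continuous_def case_prod_beta, intro continuous_intros cnt)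
  ultimately show ?thesis
    unfolding C122_def by blast
qed

text \<open>
  The compensator \<open>u z \<phi>\<^sub>x - y q \<phi>\<^sub>y\<close> removes the increments of first order, and only the bilinear
  and the quadratic increments survive; in particular neither \<open>x\<close> nor \<open>C\<close> remains.
\<close>

lemma jump_ansatz:
  assumes "y \<ge> 0"
  shows "jump (ansatz A B C) u q t x y = (\<lambda>z. B t * y\<^sup>2 * (q z)\<^sup>2 - A t * u * y * z * q z)"
  unfolding jump_def dx_ansatz dy_ansatz[OF assms]
  by (simp add: ansatz_def power2_eq_square algebra_simps)

text \<open>
  The differential equations for \<open>A\<close>, \<open>B\<close> and \<open>C\<close> cancel all terms of the operator that are free of
  controls, except \<open>- R B y\<^sup>2\<close>.
\<close>

lemma L_op_ansatz:
  assumes "T > 0" "t \<in> {0..T}" "y \<ge> 0"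
    and "(A has_real_derivative - r t * A t) (at t within {0..T})"
    and "(B has_real_derivative - R * B t) (at t within {0..T})"
    and "(C has_real_derivative - (mu0 v * (\<kappa> - \<kappa>r)) * A t) (at t within {0..T})"
  shows "L_op T \<kappa> \<kappa>r r \<mu> \<sigma> v \<pi> u p q (ansatz A B C) t x y =
     ereal (B t * y\<^sup>2 * (p\<^sup>2 - R) + A t * y * (\<pi> * (\<mu> t - r t) + mu0 v * \<kappa>r * u + \<pi> * \<sigma> t * p))
     + ext_integral v (\<lambda>z. B t * y\<^sup>2 * (q z)\<^sup>2 - A t * u * y * z * q z)"
  unfolding L_op_def jump_ansatz[OF \<open>y \<ge> 0\<close>] dx_ansatz dx_dx_ansatz
    dy_dx_ansatz[OF \<open>y \<ge> 0\<close>] dy_dy_ansatz[OF \<open>y \<ge> 0\<close>] dt_ansatz[OF assms(4-6,2,1)]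
  by (simp add: ansatz_def power2_eq_square algebra_simps)


section \<open>Integrals with values in the extended reals\<close>

lemma ext_integral_integrable:
  assumes "integrable v f"
  shows "integral_exists v f" "ext_integral v f = ereal (integral\<^sup>L v f)"
proof -
  have fin: "(\<integral>\<^sup>+z. ennreal (f z) \<partial>v) \<noteq> \<infinity>" "(\<integral>\<^sup>+z. ennreal (- f z) \<partial>v) \<noteq> \<infinity>"
    and meas: "f \<in> borel_measurable v"
    using assms by (auto simp: real_integrable_def)
  show "integral_exists v f"
    using fin meas by (simp add: integral_exists_def less_top)
  have eq: "enn2ereal a = ereal (enn2real a)" if "a \<noteq> \<infinity>" for a
    using that by (cases a) (auto simp: enn2ereal_ennreal)
  show "ext_integral v f = ereal (integral\<^sup>L v f)"
    unfolding ext_integral_def real_lebesgue_integral_def[OF assms]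
    using fin by (simp add: eq)
qed

text \<open>
  Monotonicity against an integrable minorant needs no integrability of \<open>f\<close>: the minorant keeps the
  negative part of \<open>f\<close> finite, and if the positive part is infinite, so is the integral.
\<close>

lemma ext_integral_lower_bound:
  assumes f: "f \<in> borel_measurable v" and g: "integrable v g" and le: "\<And>z. g z \<le> f z"
  shows "integral_exists v f" "ereal (integral\<^sup>L v g) \<le> ext_integral v f"
proof -
  have "(\<integral>\<^sup>+z. ennreal (- f z) \<partial>v) \<le> (\<integral>\<^sup>+z. ennreal (- g z) \<partial>v)"
    by (intro nn_integral_mono ennreal_leI) (simp add: le)
  also have "\<dots> < \<infinity>"
    using g by (simp add: real_integrable_def less_top)
  finally have neg: "(\<integral>\<^sup>+z. ennreal (- f z) \<partial>v) < \<infinity>" .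
  then show "integral_exists v f"
    using f by (simp add: integral_exists_def)
  show "ereal (integral\<^sup>L v g) \<le> ext_integral v f"
  proof (cases "(\<integral>\<^sup>+z. ennreal (f z) \<partial>v) = \<infinity>")
    case True
    have "ext_integral v f = \<infinity>"
      unfolding ext_integral_def True using neg
      by (cases "\<integral>\<^sup>+z. ennreal (- f z) \<partial>v") (auto simp: enn2ereal_ennreal)
    then show ?thesis by simp
  next
    case False
    then have "integrable v f"
      using f neg by (simp add: real_integrable_def)
    then show ?thesis
      using integral_mono[OF g] le by (simp add: ext_integral_integrable)
  qed
qed


section \<open>The saddle point\<close>

text \<open>
  The equations that relate \<open>\<pi>\<close> and \<open>u\<close> to \<open>m\<close> and \<open>l\<close> are the first-order conditions for a minimum
  at \<open>p = - m\<close>, \<open>q = l z\<close>.  They turn \<open>p\<^sup>2\<close> into \<open>(p + m)\<^sup>2\<close> and \<open>q\<^sup>2\<close> into \<open>(q - l z)\<^sup>2\<close>, and \<open>R\<close> is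
  exactly what the two completed squares leave over.
\<close>

lemma L_op_nonneg:
  assumes z2: "integrable v (\<lambda>z. z\<^sup>2)" and z: "(\<lambda>z. z) \<in> borel_measurable v"
    and q: "q \<in> borel_measurable v" and "b \<ge> 0"
    and \<pi>: "a * \<pi> * s = 2 * b * y * m" and u: "a * u = 2 * b * y * l"
    and d: "d = m * s" and k: "k = l * sigma0_sq v"
    and R: "R = l\<^sup>2 * sigma0_sq v + m\<^sup>2"
  defines "f \<equiv> \<lambda>z. b * y\<^sup>2 * (q z)\<^sup>2 - a * u * y * z * q z"
  shows "integral_exists v f"
    and "0 \<le> ereal (b * y\<^sup>2 * (p\<^sup>2 - R) + a * y * (\<pi> * d + k * u + \<pi> * s * p)) + ext_integral v f"
proof -
  have f: "f z = b * y\<^sup>2 * (q z - l * z)\<^sup>2 - b * y\<^sup>2 * l\<^sup>2 * z\<^sup>2" for z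
    unfolding f_def u by (simp add: power2_eq_square algebra_simps)
  have le: "- (b * y\<^sup>2 * l\<^sup>2) * z\<^sup>2 \<le> f z" for z
    unfolding f using \<open>b \<ge> 0\<close> by simp
  have meas: "f \<in> borel_measurable v"
    unfolding f_def using q z by measurable
  have int: "integrable v (\<lambda>z. - (b * y\<^sup>2 * l\<^sup>2) * z\<^sup>2)"
    using z2 by (rule integrable_mult_right)
  show "integral_exists v f"
    by (rule ext_integral_lower_bound(1)[OF meas int le])
  have "ereal (integral\<^sup>L v (\<lambda>z. - (b * y\<^sup>2 * l\<^sup>2) * z\<^sup>2)) \<le> ext_integral v f"
    by (rule ext_integral_lower_bound(2)[OF meas int le])
  then have lower: "ereal (- (b * y\<^sup>2 * l\<^sup>2) * sigma0_sq v) \<le> ext_integral v f"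
    unfolding sigma0_sq_def by simp
  have "a * y * (\<pi> * d + k * u + \<pi> * s * p)
      = a * \<pi> * s * y * (m + p) + a * u * (y * l * sigma0_sq v)"
    unfolding d k by (simp add: algebra_simps)
  also have "\<dots> = 2 * b * y\<^sup>2 * (m * (m + p) + l\<^sup>2 * sigma0_sq v)"
    unfolding \<pi> u by (simp add: power2_eq_square algebra_simps)
  finally have "b * y\<^sup>2 * (p\<^sup>2 - R) + a * y * (\<pi> * d + k * u + \<pi> * s * p)
      = b * y\<^sup>2 * (p + m)\<^sup>2 + b * y\<^sup>2 * l\<^sup>2 * sigma0_sq v"
    unfolding R by (simp add: power2_eq_square algebra_simps)
  then have "- (b * y\<^sup>2 * l\<^sup>2) * sigma0_sq v
      + (b * y\<^sup>2 * (p\<^sup>2 - R) + a * y * (\<pi> * d + k * u + \<pi> * s * p)) = b * y\<^sup>2 * (p + m)\<^sup>2"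
    by simp
  then have "0 \<le> ereal (b * y\<^sup>2 * (p\<^sup>2 - R) + a * y * (\<pi> * d + k * u + \<pi> * s * p))
      + ereal (- (b * y\<^sup>2 * l\<^sup>2) * sigma0_sq v)"
    using \<open>b \<ge> 0\<close> by (simp add: add.commute)
  also have "\<dots> \<le> ereal (b * y\<^sup>2 * (p\<^sup>2 - R) + a * y * (\<pi> * d + k * u + \<pi> * s * p)) + ext_integral v f"
    by (intro add_left_mono lower)
  finally show "0 \<le> ereal (b * y\<^sup>2 * (p\<^sup>2 - R) + a * y * (\<pi> * d + k * u + \<pi> * s * p)) + ext_integral v f" .
qed

text \<open>
  At \<open>p = - m\<close>, \<open>q = l z\<close> the operator is constant in \<open>(\<pi>, u)\<close>: the diffusive part of
  \<open>\<pi>\<close> cancels its drift and the jump part of \<open>u\<close> cancels its drift.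
\<close>

lemma L_op_zero:
  fixes a b u y :: real
  assumes z2: "integrable v (\<lambda>z. z\<^sup>2)"
    and d: "d = m * s" and k: "k = l * sigma0_sq v"
    and R: "R = l\<^sup>2 * sigma0_sq v + m\<^sup>2"
  defines "f \<equiv> \<lambda>z. b * y\<^sup>2 * (l * z)\<^sup>2 - a * u * y * z * (l * z)"
  shows "integral_exists v f"
    and "ereal (b * y\<^sup>2 * ((- m)\<^sup>2 - R) + a * y * (\<pi> * d + k * u + \<pi> * s * (- m))) + ext_integral v f = 0"
proof -
  have f: "f = (\<lambda>z. (b * y\<^sup>2 * l\<^sup>2 - a * u * y * l) * z\<^sup>2)"
    unfolding f_def by (simp add: fun_eq_iff power2_eq_square algebra_simps)
  have int: "integrable v f"
    unfolding f using z2 by (rule integrable_mult_right)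
  then show "integral_exists v f"
    by (rule ext_integral_integrable)
  have "integral\<^sup>L v f = (b * y\<^sup>2 * l\<^sup>2 - a * u * y * l) * sigma0_sq v"
    unfolding f sigma0_sq_def by simp
  then show "ereal (b * y\<^sup>2 * ((- m)\<^sup>2 - R) + a * y * (\<pi> * d + k * u + \<pi> * s * (- m))) + ext_integral v f = 0"
    unfolding ext_integral_integrable(2)[OF int] d k R
    by (simp add: power2_eq_square algebra_simps)
qed


section \<open>The coefficients of the solution\<close>

lemma integral_from_has_derivative:
  assumes "continuous_on {0..T} g" "t \<in> {0..T}"
  shows "((\<lambda>s. integral {s..T} g) has_real_derivative - g t) (at t within {0..T})"
  using integral_has_vector_derivative'[OF assms]
  by (simp add: has_real_derivative_iff_has_vector_derivative)

lemma exp_integral_from_has_derivative: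
  assumes "continuous_on {0..T} g" "t \<in> {0..T}"
  shows "((\<lambda>s. exp (integral {s..T} g)) has_real_derivative - g t * exp (integral {t..T} g))
    (at t within {0..T})"
  using integral_from_has_derivative[OF assms] by (auto intro!: derivative_eq_intros)

theorem theorem4p1:
  fixes T \<theta> \<kappa> \<kappa>r \<sigma>low :: real
    and r \<mu> \<sigma> :: "real \<Rightarrow> real"
    and K :: "real set" and v :: "real measure"
  assumes "T > 0" and "\<theta> > 0" and "0 < \<kappa>" and "\<kappa> \<le> \<kappa>r"
    and "\<And>t. t \<in> {0..T} \<Longrightarrow> r t > 0"
    and "\<And>t. t \<in> {0..T} \<Longrightarrow> \<mu> t > r t"
    and "\<sigma>low > 0" and "\<And>t. t \<in> {0..T} \<Longrightarrow> \<sigma> t > \<sigma>low"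
    and "bounded (r ` {0..T})" and "bounded (\<mu> ` {0..T})" and "bounded (\<sigma> ` {0..T})"
    and "K \<subseteq> {0<..}" and "sets v = sets (restrict_space borel K)"
    and "integrable v (\<lambda>z. z)" and "mu0 v > 0"
    and "integrable v (\<lambda>z. z\<^sup>2)" and "sigma0_sq v > 0"
    and "continuous_on {0..T} r"
    and "continuous_on {0..T} (rho v \<kappa>r r \<mu> \<sigma>)"
  shows "C122 T (phi T \<theta> \<kappa> \<kappa>r r \<mu> \<sigma> v)
    \<and> hjbi_saddle T \<kappa> \<kappa>r r \<mu> \<sigma> v (phi T \<theta> \<kappa> \<kappa>r r \<mu> \<sigma> v)
        (pi_hat T \<theta> \<kappa>r r \<mu> \<sigma> v) (u_hat T \<theta> \<kappa>r r \<mu> \<sigma> v) (p_hat r \<mu> \<sigma>) (q_hat \<kappa>r v)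
    \<and> (\<forall>x. \<forall>y\<ge>0. phi T \<theta> \<kappa> \<kappa>r r \<mu> \<sigma> v T x y = x * y + 1 / (2 * \<theta>) * y\<^sup>2)"
proof -
  define A where "A t = exp (integral {t..T} r)" for t
  define B where "B t = 1 / (2 * \<theta>) * exp (integral {t..T} (rho v \<kappa>r r \<mu> \<sigma>))" for t
  define C where "C t = mu0 v * (\<kappa> - \<kappa>r) * integral {t..T} A" for t
  note r_cont = \<open>continuous_on {0..T} r\<close>
    and rho_cont = \<open>continuous_on {0..T} (rho v \<kappa>r r \<mu> \<sigma>)\<close>
    and z2 = \<open>integrable v (\<lambda>z. z\<^sup>2)\<close>
  have phi: "phi T \<theta> \<kappa> \<kappa>r r \<mu> \<sigma> v = ansatz A B C"
    by (simp add: fun_eq_iff phi_def ansatz_def A_def[abs_def] B_def C_def)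
  have A_deriv: "(A has_real_derivative - r t * A t) (at t within {0..T})" if "t \<in> {0..T}" for t
    using exp_integral_from_has_derivative[OF r_cont that] by (simp add: A_def[abs_def])
  have B_deriv: "(B has_real_derivative - rho v \<kappa>r r \<mu> \<sigma> t * B t) (at t within {0..T})"
    if "t \<in> {0..T}" for t
    using DERIV_cmult[OF exp_integral_from_has_derivative[OF rho_cont that], of "1 / (2 * \<theta>)"]
    by (simp add: B_def[abs_def] mult.left_commute)
  have A_cont: "continuous_on {0..T} A"
    by (rule DERIV_continuous_on[OF A_deriv])
  have B_cont: "continuous_on {0..T} B"
    by (rule DERIV_continuous_on[OF B_deriv])
  have C_deriv: "(C has_real_derivative - (mu0 v * (\<kappa> - \<kappa>r)) * A t) (at t within {0..T})"
    if "t \<in> {0..T}" for t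
    using DERIV_cmult[OF integral_from_has_derivative[OF A_cont that], of "mu0 v * (\<kappa> - \<kappa>r)"]
    by (simp add: C_def[abs_def])
  have "C122 T (ansatz A B C)"
    by (rule C122_ansatz[OF \<open>T > 0\<close> A_deriv B_deriv C_deriv]; assumption?)
      (intro continuous_intros r_cont rho_cont A_cont B_cont)+
  moreover have "hjbi_saddle T \<kappa> \<kappa>r r \<mu> \<sigma> v (ansatz A B C)
        (pi_hat T \<theta> \<kappa>r r \<mu> \<sigma> v) (u_hat T \<theta> \<kappa>r r \<mu> \<sigma> v) (p_hat r \<mu> \<sigma>) (q_hat \<kappa>r v)"
    unfolding hjbi_saddle_def Let_def
  proof (intro ballI allI impI)
    fix t x y :: real
    assume "t \<in> {0..<T}" and y: "y \<ge> 0"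
    then have t: "t \<in> {0..T}" by simp
    let ?\<pi> = "pi_hat T \<theta> \<kappa>r r \<mu> \<sigma> v t x y" and ?u = "u_hat T \<theta> \<kappa>r r \<mu> \<sigma> v t x y"
    let ?p = "p_hat r \<mu> \<sigma> t x y" and ?q = "\<lambda>z. q_hat \<kappa>r v t z x y"
    define l where "l = mu0 v * \<kappa>r / sigma0_sq v"
    define m where "m = (\<mu> t - r t) / \<sigma> t"
    have "\<sigma> t > 0"
      using assms(7,8) t by (meson less_trans)
    have z: "(\<lambda>z. z) \<in> borel_measurable v"
      using \<open>integrable v (\<lambda>z. z)\<close> by simp
    have "B t \<ge> 0"
      using \<open>\<theta> > 0\<close> by (simp add: B_def)
    \<comment> \<open>The exponential in the candidate controls is the ratio \<open>2 \<theta> B / A\<close>.\<close>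
    have sub: "{t..T} \<subseteq> {0..T}" using t by auto
    have "integral {t..T} (\<lambda>s. rho v \<kappa>r r \<mu> \<sigma> s - r s)
        = integral {t..T} (rho v \<kappa>r r \<mu> \<sigma>) - integral {t..T} r"
      using continuous_on_subset[OF rho_cont sub] continuous_on_subset[OF r_cont sub]
      by (intro integral_diff integrable_continuous_real)
    then have E: "A t * exp (integral {t..T} (\<lambda>s. rho v \<kappa>r r \<mu> \<sigma> s - r s)) = 2 * \<theta> * B t"
      using \<open>\<theta> > 0\<close> by (simp add: A_def B_def exp_diff)
    have "A t * ?\<pi> * \<sigma> t
        = (A t * exp (integral {t..T} (\<lambda>s. rho v \<kappa>r r \<mu> \<sigma> s - r s))) * (m * y / \<theta>)"
      using \<open>\<sigma> t > 0\<close> by (simp add: pi_hat_def m_def power2_eq_square mult_ac)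
    also have "\<dots> = 2 * B t * y * m"
      unfolding E using \<open>\<theta> > 0\<close> by simp
    finally have \<pi>: "A t * ?\<pi> * \<sigma> t = 2 * B t * y * m" .
    have "A t * ?u
        = (A t * exp (integral {t..T} (\<lambda>s. rho v \<kappa>r r \<mu> \<sigma> s - r s))) * (l * y / \<theta>)"
      by (simp add: u_hat_def l_def mult_ac)
    also have "\<dots> = 2 * B t * y * l"
      unfolding E using \<open>\<theta> > 0\<close> by simp
    finally have u: "A t * ?u = 2 * B t * y * l" .
    have d: "\<mu> t - r t = m * \<sigma> t"
      using \<open>\<sigma> t > 0\<close> by (simp add: m_def)
    have k: "mu0 v * \<kappa>r = l * sigma0_sq v"
      using \<open>sigma0_sq v > 0\<close> by (simp add: l_def)
    have R: "rho v \<kappa>r r \<mu> \<sigma> t = l\<^sup>2 * sigma0_sq v + m\<^sup>2"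
      using \<open>sigma0_sq v > 0\<close> by (simp add: rho_def l_def m_def power2_eq_square)
    have p_hat: "?p = - m" and q_hat: "?q = (\<lambda>z. l * z)"
      by (simp_all add: p_hat_def m_def q_hat_def l_def)
    note L = L_op_ansatz[where r = r and A = A and B = B and C = C, OF \<open>T > 0\<close> t y A_deriv[OF t] B_deriv[OF t] C_deriv[OF t]]
    have nonneg: "integral_exists v (jump (ansatz A B C) ?u q t x y) \<and>
        L_op T \<kappa> \<kappa>r r \<mu> \<sigma> v ?\<pi> ?u p q (ansatz A B C) t x y \<ge> 0" if "q \<in> borel_measurable v" for p q
      unfolding jump_ansatz[OF y] L
      using L_op_nonneg[OF z2 z that \<open>B t \<ge> 0\<close> \<pi> u d k R] by simp
    have zero: "integral_exists v (jump (ansatz A B C) u ?q t x y) \<and>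
        L_op T \<kappa> \<kappa>r r \<mu> \<sigma> v \<pi> u ?p ?q (ansatz A B C) t x y = 0" for \<pi> u
      unfolding jump_ansatz[OF y] L p_hat q_hat
      using L_op_zero[OF z2 d k R] by simp
    have "?u \<ge> 0"
      using \<open>\<theta> > 0\<close> \<open>mu0 v > 0\<close> \<open>sigma0_sq v > 0\<close> \<open>0 < \<kappa>\<close> \<open>\<kappa> \<le> \<kappa>r\<close> y by (simp add: u_hat_def)
    moreover have "?q \<in> borel_measurable v"
      unfolding q_hat using z by measurable
    ultimately show "?u \<ge> 0 \<and> ?q \<in> borel_measurable v \<and>
        (integral_exists v (jump (ansatz A B C) ?u ?q t x y) \<and>
         L_op T \<kappa> \<kappa>r r \<mu> \<sigma> v ?\<pi> ?u ?p ?q (ansatz A B C) t x y = 0) \<and>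
        (\<forall>p. \<forall>q\<in>borel_measurable v.
           integral_exists v (jump (ansatz A B C) ?u q t x y) \<and>
           L_op T \<kappa> \<kappa>r r \<mu> \<sigma> v ?\<pi> ?u p q (ansatz A B C) t x y \<ge> 0) \<and>
        (\<forall>\<pi>. \<forall>u\<ge>0.
           integral_exists v (jump (ansatz A B C) u ?q t x y) \<and>
           L_op T \<kappa> \<kappa>r r \<mu> \<sigma> v \<pi> u ?p ?q (ansatz A B C) t x y \<le> 0)"
      using nonneg zero by simp
  qed
  moreover have "phi T \<theta> \<kappa> \<kappa>r r \<mu> \<sigma> v T x y = x * y + 1 / (2 * \<theta>) * y\<^sup>2" for x y
    by (simp add: phi_def)
  ultimately show ?thesis
    unfolding phi by blast
qed

end
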